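(* Let $k\geq 2$ be an integer and let $n=2^m$ be a power of two, where $m\geq 2$ is an integer. Then \[\mathrm{ex}(n,K^k_{k+1},\mathcal{S}^kC_4)\geq\frac{n^{k-1/2}}{(k+1)!}-n^{k-1}\] if $m$ is even, and \[\mathrm{ex}(n,K^k_{k+1},\mathcal{S}^kC_4)\geq\frac{n^{k-1/2}}{\sqrt{2}\,(k+1)!}-n^{k-1}\] if $m$ is odd.
   Context: For an integer $k\geq2$ and a graph $F$, the $k$-uniform suspension $\mathcal{S}^kF$ is the $k$-uniform hypergraph with vertex set $S\cup V(F)$ and edge set $\{S\cup e:\,e\in E(F)\}$, where $S$ is a set of size $k-2$ disjoint from $V(F)$. $C_4$ is the cycle of length $4$. $K^k_t$ is the $k$-uniform clique of order $t$, i.e. the hypergraph on $t$ vertices whose edges are all $k$-element subsets. A $k$-uniform hypergraph is $H$-free if it contains no (not necessarily induced) subhypergraph isomorphic to $H$; a copy of $T$ is a subhypergraph isomorphic to $T$. For $k$-uniform hypergraphs $T$ and $H$, $\mathrm{ex}(n,T,H)$ is the maximum number of copies of $T$ in an $n$-vertex $H$-free $k$-uniform hypergraph. *)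

theory Defs
  imports Complex_Main
begin

datatype 'a hypergraph = Hypergraph (verts: "'a set") (edges: "'a set set")

definition uniform_hypergraph :: "nat \<Rightarrow> 'a hypergraph \<Rightarrow> bool" where
  "uniform_hypergraph k G \<longleftrightarrow>
     finite (verts G) \<and> (\<forall>e\<in>edges G. e \<subseteq> verts G \<and> card e = k)"

definition subhypergraph :: "'a hypergraph \<Rightarrow> 'a hypergraph \<Rightarrow> bool" where
  "subhypergraph G' G \<longleftrightarrow>
     verts G' \<subseteq> verts G \<and> edges G' \<subseteq> edges G \<and> (\<forall>e\<in>edges G'. e \<subseteq> verts G')"

definition hypergraph_iso :: "'a hypergraph \<Rightarrow> 'b hypergraph \<Rightarrow> bool" where
  "hypergraph_iso G H \<longleftrightarrow>
     (\<exists>f. bij_betw f (verts G) (verts H) \<and> edges H = (\<lambda>e. f ` e) ` edges G)"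

definition copies :: "'b hypergraph \<Rightarrow> 'a hypergraph \<Rightarrow> 'a hypergraph set" where
  "copies T G = {G'. subhypergraph G' G \<and> hypergraph_iso G' T}"

definition hypergraph_free :: "'b hypergraph \<Rightarrow> 'a hypergraph \<Rightarrow> bool" where
  "hypergraph_free H G \<longleftrightarrow> \<not> (\<exists>G'. subhypergraph G' G \<and> hypergraph_iso G' H)"

text \<open>The uniformity \<open>k\<close> of the host hypergraphs is an explicit argument, and their vertices
  are taken to be natural numbers; every hypergraph on \<open>n\<close> vertices is isomorphic to such
  a one. The set below is finite, since a hypergraph on \<open>n\<close> vertices has at most
  \<open>2 ^ n * 2 ^ (2 ^ n)\<close> subhypergraphs, and it is nonempty as soon as \<open>H\<close> has an edge.\<close>

definition ex_copies :: "nat \<Rightarrow> nat \<Rightarrow> 'b hypergraph \<Rightarrow> 'c hypergraph \<Rightarrow> nat" where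
  "ex_copies k n T H =
     Max {card (copies T G) | G :: nat hypergraph.
            uniform_hypergraph k G \<and> card (verts G) = n \<and> hypergraph_free H G}"

definition clique :: "nat \<Rightarrow> nat \<Rightarrow> nat hypergraph" where
  "clique k t = Hypergraph {..<t} {e. e \<subseteq> {..<t} \<and> card e = k}"

text \<open>A cycle in the usual sense for \<open>l \<ge> 3\<close>.\<close>

definition cycle_graph :: "nat \<Rightarrow> nat hypergraph" where
  "cycle_graph l = Hypergraph {..<l} {{i, (i + 1) mod l} | i. i < l}"

text \<open>The disjoint union with the set \<open>S\<close> of size \<open>k - 2\<close> is realised in a sum type.\<close>

definition suspension :: "nat \<Rightarrow> 'a hypergraph \<Rightarrow> (nat + 'a) hypergraph" where
  "suspension k F =
     Hypergraph ({..<k - 2} <+> verts F) ((\<lambda>e. {..<k - 2} <+> e) ` edges F)"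

end

theory Submission
  imports Defs "HOL-Algebra.Algebraic_Closure_Type" "HOL-Library.Z2" "HOL-Library.Product_Plus"
    "HOL-Library.FuncSet" "HOL-Combinatorics.Multiset_Permutations"
begin

text \<open>
  Let \<open>K\<close> be the field with \<open>q = 2 ^ \<lceil>m / 2\<rceil>\<close> elements and let the vertex set \<open>H\<close> be an additive
  subgroup of order \<open>n = 2 ^ m\<close> of the plane \<open>K \<times> K\<close>. For \<open>c \<in> K\<close> call a set of \<open>k + 1\<close> points of \<open>H\<close>
  admissible if the points sum to 0, the products of their coordinates sum to \<open>c\<close>, and no three of
  them are collinear; the edges are the \<open>k\<close>-subsets of admissible sets.

  The product of the coordinates is a quadratic form whose polar form is the determinant. Hence, if
  \<open>S\<close> has \<open>k - 2\<close> points with sum \<open>s\<close>, all edges \<open>S \<union> {x, y}\<close> satisfy \<open>det (x + s, y + s) = d\<close> with \<open>d\<close>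
  depending only on \<open>S\<close>, and \<open>d \<noteq> 0\<close> by non-collinearity. As two lines \<open>det (u, z) = d\<close> and
  \<open>det (v, z) = d\<close> with \<open>u \<noteq> v\<close> meet in at most one point, the link of \<open>S\<close> has no 4-cycle.

  There are \<open>n ^ k\<close> tuples of \<open>k + 1\<close> points of \<open>H\<close> with sum 0; for each triple of indices at most
  \<open>n ^ (k - 1) * (1 + q)\<close> of them have the three corresponding points collinear. Distributing the
  remaining tuples over the \<open>q\<close> values of \<open>c\<close> gives the bound.
\<close>

subsection \<open>Finite fields of characteristic 2\<close>

text \<open>Over an algebraically closed field \<open>p\<close> splits into linear factors. A factor
  occurring twice would survive in the derivative and give a common root of \<open>p\<close> and
  \<open>pderiv p\<close>, so the multiset of roots is a set of size
  \<open>degree p\<close>.\<close>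

lemma card_roots_separable:
  fixes p :: "'a::alg_closed_field poly"
  assumes "p \<noteq> 0" and sep: "\<And>a. poly p a = 0 \<Longrightarrow> poly (pderiv p) a \<noteq> 0"
  shows "card {a. poly p a = 0} = degree p"
proof -
  obtain A c where A: "size A = degree p" and p: "p = smult c (\<Prod>a\<in>#A. [:-a, 1:])" and "c \<noteq> 0"
    using alg_closed_imp_factorization[OF \<open>p \<noteq> 0\<close>] \<open>p \<noteq> 0\<close> leading_coeff_0_iff by metis
  have "poly p a = c * (\<Prod>b\<in>#A. a - b)" for a
    unfolding p by (simp add: poly_prod_mset image_mset.compositionality comp_def)
  moreover have "(\<Prod>b\<in>#A. a - b) = 0 \<longleftrightarrow> a \<in># A" for a
    by (induction A) auto
  ultimately have roots: "{a. poly p a = 0} = set_mset A"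
    using \<open>c \<noteq> 0\<close> by simp
  have "count A a = 1" if "a \<in># A" for a
  proof (rule ccontr)
    assume "count A a \<noteq> 1"
    moreover have "a \<in># A - {#a#} \<longleftrightarrow> count A a \<ge> 2"
      by (auto simp: in_diff_count)
    moreover have "count A a > 0"
      using that by simp
    ultimately have "a \<in># A - {#a#}"
      by linarith
    then obtain B where "A - {#a#} = add_mset a B"
      by (meson multi_member_split)
    then have B: "A = add_mset a (add_mset a B)"
      using insert_DiffM[OF that] by simp
    define s where "s = smult c (\<Prod>b\<in>#B. [:-b, 1:])"
    have s: "p = [:-a, 1:] * ([:-a, 1:] * s)"
      unfolding p B s_def by (simp only: image_mset_add_mset prod_mset.add_mset mult_smult_right)
    have "poly p a = 0"
      unfolding s by simp
    moreover have "poly (pderiv p) a = 0"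
      unfolding s pderiv_mult by simp
    ultimately show False
      using sep by blast
  qed
  then have "size A = card (set_mset A)"
    by (simp add: size_multiset_overloaded_eq)
  then show ?thesis
    by (simp add: roots A)
qed

text \<open>The set consists of the roots of \<open>X ^ q - X\<close> with \<open>q = 2 ^ r\<close>.
  Its derivative is the constant -1 because \<open>q\<close> is even, so there are exactly
  \<open>q\<close> roots; they are closed under addition because raising to the power
  \<open>q\<close> is additive in characteristic 2.\<close>

lemma exists_subfield_of_order_power_of_2:
  assumes "r \<ge> 1"
  shows "\<exists>K :: bit alg_closure set. finite K \<and> card K = 2 ^ r \<and> 0 \<in> K \<and>
           (\<forall>x\<in>K. \<forall>y\<in>K. x + y \<in> K \<and> x * y \<in> K)"
proof -
  have [simp]: "CHAR(bit) = 2"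
  proof (rule CHAR_eqI)
    show "of_nat 2 = (0 :: bit)" by simp
    show "2 dvd n" if "of_nat n = (0 :: bit)" for n
      using that by (cases "even n") (auto elim!: oddE)
  qed
  then have char: "CHAR(bit alg_closure) = 2" by simp
  then have two: "(2 :: bit alg_closure) = 0"
    by (metis of_nat_CHAR of_nat_numeral)
  define q :: nat where "q = 2 ^ r"
  have q: "q \<ge> 2"
    using assms by (simp add: q_def self_le_power)
  define p :: "bit alg_closure poly" where "p = monom 1 q - monom 1 1"
  have poly_p: "poly p a = a ^ q - a" for a
    by (simp add: p_def poly_monom)
  have deg: "degree p = q"
    unfolding p_def diff_conv_add_uminus using q by (subst degree_add_eq_left) (simp_all add: degree_monom_eq)
  have "pderiv p = -1"
  proof -
    have "of_nat q = (0 :: bit alg_closure)"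
      unfolding q_def using assms two by (simp add: power_0_left)
    then show ?thesis
      by (simp add: p_def pderiv_diff pderiv_monom flip: one_pCons)
  qed
  moreover have "p \<noteq> 0"
    using deg q by auto
  ultimately have "card {a. poly p a = 0} = q"
    using card_roots_separable[of p] deg by simp
  moreover have "finite {a. poly p a = 0}"
    using \<open>p \<noteq> 0\<close> by (rule poly_roots_finite)
  moreover have "(x + y) ^ q = x ^ q + y ^ q" for x y :: "bit alg_closure"
    by (rule freshmans_dream'[of _ r]) (simp_all add: q_def)
  ultimately show ?thesis
    using q by (intro exI[of _ "{a. poly p a = 0}"]) (auto simp: poly_p q_def power_mult_distrib)
qed

text \<open>Repeated doubling: for \<open>a\<close> in \<open>A\<close> outside a subgroup
  \<open>H\<close>, the coset \<open>a + H\<close> is disjoint from \<open>H\<close>, and since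
  \<open>a + a = 0\<close> the union of both is again closed under addition.\<close>

lemma exists_subgroup_of_order_power_of_2:
  fixes A :: "'a::ab_group_add set"
  assumes double: "\<And>x :: 'a. x + x = 0"
    and A: "0 \<in> A" "\<And>x y. x \<in> A \<Longrightarrow> y \<in> A \<Longrightarrow> x + y \<in> A"
    and "finite A" "card A = 2 ^ t" "m \<le> t"
  shows "\<exists>H \<subseteq> A. card H = 2 ^ m \<and> 0 \<in> H \<and> (\<forall>x\<in>H. \<forall>y\<in>H. x + y \<in> H)"
  using \<open>m \<le> t\<close>
proof (induction m)
  case 0
  then show ?case using A(1) by (intro exI[of _ "{0}"]) auto
next
  case (Suc m)
  then obtain H where H: "H \<subseteq> A" "card H = 2 ^ m" "0 \<in> H" "\<forall>x\<in>H. \<forall>y\<in>H. x + y \<in> H"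
    by auto
  have "card H < card A"
    using H(2) assms(5) Suc.prems by simp
  then obtain a where a: "a \<in> A" "a \<notin> H"
    using H(1) by (metis order_less_irrefl subset_antisym subsetI)
  have cancel: "x + (x + y) = y" for x y :: 'a
    by (simp add: double flip: add.assoc)
  have "finite H"
    using H(1) \<open>finite A\<close> by (rule finite_subset)
  have "H \<inter> (+) a ` H = {}"
  proof -
    have "a + h \<notin> H" if "h \<in> H" for h
      using a(2) H(4) that cancel[of h a] by (metis add.commute)
    then show ?thesis by auto
  qed
  then have "card (H \<union> (+) a ` H) = 2 ^ Suc m"
    using \<open>finite H\<close> H(2) by (subst card_Un_disjoint) (auto simp: card_image)
  moreover have "H \<union> (+) a ` H \<subseteq> A"
    using H(1) a(1) A(2) by auto
  moreover have "x + y \<in> H \<union> (+) a ` H" if xy: "x \<in> H \<union> (+) a ` H" "y \<in> H \<union> (+) a ` H" for x y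
    using xy
  proof (elim UnE imageE)
    assume "x \<in> H" "y \<in> H"
    then show ?thesis using H(4) by blast
  next
    fix v assume "x \<in> H" "v \<in> H" "y = a + v"
    then have "x + v \<in> H" "x + y = a + (x + v)"
      using H(4) by (auto simp: add.left_commute)
    then show ?thesis by blast
  next
    fix u assume "u \<in> H" "x = a + u" "y \<in> H"
    then have "u + y \<in> H" "x + y = a + (u + y)"
      using H(4) by (auto simp: add.assoc)
    then show ?thesis by blast
  next
    fix u v assume uv: "u \<in> H" "x = a + u" "v \<in> H" "y = a + v"
    then have "x + y = a + (a + (u + v))"
      by (simp add: add_ac)
    also have "\<dots> = u + v"
      by (rule cancel)
    finally have "x + y \<in> H"
      using uv(1,3) H(4) by metis
    then show ?thesis by blast
  qed
  ultimately show ?case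
    using H(3) by (intro exI[of _ "H \<union> (+) a ` H"]) auto
qed

lemma double_alg_closure_bit: "x + x = (0 :: bit alg_closure)"
proof -
  have "to_ac ((1 :: bit) + 1) = 0"
    by simp
  then have "1 + 1 = (0 :: bit alg_closure)"
    by (simp only: to_ac_add to_ac_1)
  then have "x * (1 + 1) = 0"
    by (simp only: mult_zero_right)
  then show ?thesis
    by (simp only: distrib_left mult_1_right)
qed

subsection \<open>Copies in hypergraphs\<close>

text \<open>A copy is determined by its vertex set and its edge set. The bound depends only on the
  number of vertices, so the set under \<open>Max\<close> in \<open>ex_copies\<close> is bounded and
  hence finite.\<close>

lemma finite_copies:
  assumes "finite (verts G)"
  shows "finite (copies T G)"
    and "card (copies T G) \<le> 2 ^ card (verts G) * 2 ^ 2 ^ card (verts G)"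
proof -
  let ?P = "Pow (verts G) \<times> Pow (Pow (verts G))"
  have sub: "copies T G \<subseteq> (\<lambda>(A, B). Hypergraph A B) ` ?P"
  proof
    fix G' assume "G' \<in> copies T G"
    then have "(verts G', edges G') \<in> ?P"
      by (force simp: copies_def subhypergraph_def)
    then show "G' \<in> (\<lambda>(A, B). Hypergraph A B) ` ?P"
      by (intro image_eqI[of _ _ "(verts G', edges G')"]) auto
  qed
  have fin: "finite ?P" using assms by simp
  then show "finite (copies T G)"
    using sub by (meson finite_imageI finite_subset)
  have "card (copies T G) \<le> card ?P"
    using fin sub by (rule surj_card_le)
  then show "card (copies T G) \<le> 2 ^ card (verts G) * 2 ^ 2 ^ card (verts G)"
    using assms by (simp add: card_cartesian_product card_Pow)
qed

lemma ex_copies_nat_ge: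
  fixes G :: "nat hypergraph"
  assumes "uniform_hypergraph k G" "card (verts G) = n" "hypergraph_free F G"
  shows "card (copies T G) \<le> ex_copies k n T F"
  unfolding ex_copies_def
proof (rule Max_ge)
  have "{card (copies T G) | G :: nat hypergraph.
            uniform_hypergraph k G \<and> card (verts G) = n \<and> hypergraph_free F G}
        \<subseteq> {..2 ^ n * 2 ^ 2 ^ n}"
    using finite_copies(2) by (auto simp: uniform_hypergraph_def)
  then show "finite {card (copies T G) | G :: nat hypergraph.
            uniform_hypergraph k G \<and> card (verts G) = n \<and> hypergraph_free F G}"
    by (rule finite_subset) simp
qed (use assms in blast)

definition image_hypergraph :: "('a \<Rightarrow> 'b) \<Rightarrow> 'a hypergraph \<Rightarrow> 'b hypergraph" where
  "image_hypergraph h G = Hypergraph (h ` verts G) ((`) h ` edges G)"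

lemma hypergraph_iso_image_hypergraph:
  assumes inj: "inj_on h (verts G)" and E: "\<forall>e\<in>edges G. e \<subseteq> verts G"
  shows "hypergraph_iso (image_hypergraph h G) T \<longleftrightarrow> hypergraph_iso G T"
proof
  assume "hypergraph_iso (image_hypergraph h G) T"
  then obtain f where f: "bij_betw f (h ` verts G) (verts T)"
    "edges T = (\<lambda>e. f ` e) ` (`) h ` edges G"
    by (auto simp: hypergraph_iso_def image_hypergraph_def)
  have "bij_betw (f \<circ> h) (verts G) (verts T)"
    using inj f(1) by (intro bij_betw_trans[of h]) (auto simp: bij_betw_def)
  then show "hypergraph_iso G T"
    unfolding hypergraph_iso_def f(2)
    by (intro exI[of _ "f \<circ> h"]) (auto simp: image_comp comp_def)
next
  assume "hypergraph_iso G T"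
  then obtain f where f: "bij_betw f (verts G) (verts T)" "edges T = (\<lambda>e. f ` e) ` edges G"
    by (auto simp: hypergraph_iso_def)
  define g where "g = the_inv_into (verts G) h"
  have g: "g (h v) = v" if "v \<in> verts G" for v
    using inj that by (simp add: g_def the_inv_into_f_f)
  have "bij_betw g (h ` verts G) (verts G)"
    unfolding g_def using inj by (simp add: bij_betw_the_inv_into bij_betw_imageI)
  then have "bij_betw (f \<circ> g) (h ` verts G) (verts T)"
    using f(1) by (rule bij_betw_trans)
  moreover have "(f \<circ> g) ` h ` e = f ` e" if "e \<in> edges G" for e
    using E that g by (force simp: image_iff)
  then have "edges T = (\<lambda>e. (f \<circ> g) ` e) ` (`) h ` edges G"
    unfolding f(2) image_image[of _ "(`) h"] by (intro image_cong) simp_all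
  ultimately show "hypergraph_iso (image_hypergraph h G) T"
    unfolding hypergraph_iso_def image_hypergraph_def by auto
qed

lemma subhypergraph_image_hypergraph:
  "subhypergraph G' G \<Longrightarrow> subhypergraph (image_hypergraph h G') (image_hypergraph h G)"
  unfolding subhypergraph_def image_hypergraph_def by (auto 4 3)

lemma image_hypergraph_inverse:
  assumes "inj_on h (verts G)" and "\<forall>e\<in>edges G. e \<subseteq> verts G"
  shows "image_hypergraph (the_inv_into (verts G) h) (image_hypergraph h G) = G"
proof -
  have "the_inv_into (verts G) h ` h ` e = e" if "e \<subseteq> verts G" for e
    using assms(1) that by (force simp: the_inv_into_f_f image_iff subset_iff)
  moreover have "(\<lambda>e. the_inv_into (verts G) h ` h ` e) ` edges G = (\<lambda>e. e) ` edges G"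
    using assms(2) calculation by (intro image_cong) auto
  ultimately show ?thesis
    by (simp add: image_hypergraph_def image_image)
qed

lemma subhypergraph_edges: "subhypergraph G' G \<Longrightarrow> \<forall>e\<in>edges G'. e \<subseteq> verts G'"
  by (simp add: subhypergraph_def)

text \<open>The hosts in \<open>ex_copies\<close> have natural numbers as vertices, whereas the
  construction has points of a plane. An injective relabelling bridges the gap.\<close>

lemma ex_copies_ge:
  fixes G :: "'a hypergraph"
  assumes unif: "uniform_hypergraph k G" and n: "card (verts G) = n"
    and free: "hypergraph_free F G"
  shows "card (copies T G) \<le> ex_copies k n T F"
proof -
  have fin: "finite (verts G)" and E: "\<forall>e\<in>edges G. e \<subseteq> verts G"
    using unif by (auto simp: uniform_hypergraph_def)
  obtain h :: "'a \<Rightarrow> nat" where h: "inj_on h (verts G)"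
    using finite_imp_inj_to_nat_seg[OF fin] by blast
  \<comment> \<open>Going back along \<open>g\<close> turns a forbidden copy in the relabelled
    hypergraph into one in \<open>G\<close>.\<close>
  define g where "g = the_inv_into (verts G) h"
  let ?G = "image_hypergraph h G"
  have inv: "image_hypergraph g ?G = G"
    unfolding g_def by (rule image_hypergraph_inverse[OF h E])
  have g: "inj_on g (verts ?G)"
    unfolding g_def using h by (simp add: image_hypergraph_def inj_on_the_inv_into)
  have "card (h ` e) = k" if "e \<in> edges G" for e
    using unif h that by (metis card_image inj_on_subset uniform_hypergraph_def)
  then have "uniform_hypergraph k ?G"
    using fin E by (fastforce simp: uniform_hypergraph_def image_hypergraph_def)
  moreover have "card (verts ?G) = n"
    using h n by (simp add: image_hypergraph_def card_image)
  moreover have "hypergraph_free F ?G"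
    unfolding hypergraph_free_def
  proof safe
    fix G' assume G': "subhypergraph G' ?G" "hypergraph_iso G' F"
    have "inj_on g (verts G')"
      using g G'(1) by (auto simp: subhypergraph_def intro: inj_on_subset)
    then have "hypergraph_iso (image_hypergraph g G') F"
      using G' by (simp add: hypergraph_iso_image_hypergraph subhypergraph_edges)
    moreover have "subhypergraph (image_hypergraph g G') G"
      using subhypergraph_image_hypergraph[OF G'(1), of g] by (simp add: inv)
    ultimately show False
      using free by (auto simp: hypergraph_free_def)
  qed
  ultimately have "card (copies T ?G) \<le> ex_copies k n T F"
    by (rule ex_copies_nat_ge)
  moreover have "card (copies T G) \<le> card (copies T ?G)"
  proof (rule card_inj_on_le)
    show "image_hypergraph h ` copies T G \<subseteq> copies T ?G"
    proof safe
      fix G' assume "G' \<in> copies T G"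
      then have G': "subhypergraph G' G" "hypergraph_iso G' T"
        by (auto simp: copies_def)
      have "inj_on h (verts G')"
        using h G'(1) by (auto simp: subhypergraph_def intro: inj_on_subset)
      then show "image_hypergraph h G' \<in> copies T ?G"
        using G' by (simp add: copies_def hypergraph_iso_image_hypergraph subhypergraph_edges
            subhypergraph_image_hypergraph)
    qed
    show "inj_on (image_hypergraph h) (copies T G)"
    proof (rule inj_onI)
      fix G1 G2 assume G12: "G1 \<in> copies T G" "G2 \<in> copies T G"
        "image_hypergraph h G1 = image_hypergraph h G2"
      have "inj_on ((`) h) (Pow (verts G))"
        using h by (rule inj_on_image_Pow)
      then have *: "h ` A = h ` B \<Longrightarrow> A = B" if "A \<subseteq> verts G" "B \<subseteq> verts G" for A B
        using that by (auto dest: inj_onD)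
      have v: "verts G1 \<subseteq> verts G" "verts G2 \<subseteq> verts G" "edges G1 \<subseteq> Pow (verts G)" "edges G2 \<subseteq> Pow (verts G)"
        using G12(1,2) E by (auto simp: copies_def subhypergraph_def)
      have "verts G1 = verts G2"
        using G12(3) * v by (simp add: image_hypergraph_def)
      moreover have "edges G1 = edges G2"
        using G12(3) v(3,4) \<open>inj_on ((`) h) (Pow (verts G))\<close>
        by (simp add: image_hypergraph_def inj_on_image_eq_iff)
      ultimately show "G1 = G2"
        by (simp add: hypergraph.expand)
    qed
    show "finite (copies T ?G)"
      using fin by (intro finite_copies) (simp add: image_hypergraph_def)
  qed
  ultimately show ?thesis by simp
qed

text \<open>Each \<open>Q\<close> carries the complete \<open>k\<close>-uniform hypergraph on it,
  and different \<open>Q\<close> give different vertex sets. Any enumeration of \<open>Q\<close> is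
  the required isomorphism.\<close>

lemma card_cliques_le_copies:
  assumes fin: "finite (verts G)" and \<Q>: "\<And>Q. Q \<in> \<Q> \<Longrightarrow> Q \<subseteq> verts G \<and> card Q = t"
    and E: "\<And>Q e. Q \<in> \<Q> \<Longrightarrow> e \<subseteq> Q \<Longrightarrow> card e = k \<Longrightarrow> e \<in> edges G"
  shows "card \<Q> \<le> card (copies (clique k t) G)"
proof (rule card_inj_on_le)
  show "inj_on (\<lambda>Q. Hypergraph Q {e. e \<subseteq> Q \<and> card e = k}) \<Q>"
    by (rule inj_onI) simp
  show "(\<lambda>Q. Hypergraph Q {e. e \<subseteq> Q \<and> card e = k}) ` \<Q> \<subseteq> copies (clique k t) G"
  proof safe
    fix Q assume Q: "Q \<in> \<Q>"
    then have "finite Q"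
      using \<Q> fin finite_subset by blast
    then obtain f where f: "bij_betw f Q {..<t}"
      using \<Q>[OF Q] by (metis atLeast0LessThan ex_bij_betw_finite_nat)
    have "(`) f ` {e. e \<subseteq> Q \<and> card e = k} = {e. e \<subseteq> {..<t} \<and> card e = k}"
    proof (intro subset_antisym subsetI)
      fix e assume "e \<in> (`) f ` {e. e \<subseteq> Q \<and> card e = k}"
      then show "e \<in> {e. e \<subseteq> {..<t} \<and> card e = k}"
        using f by (auto simp: bij_betw_def card_image inj_on_subset)
    next
      fix e assume e: "e \<in> {e. e \<subseteq> {..<t} \<and> card e = k}"
      then obtain d where d: "d \<subseteq> Q" "e = f ` d"
        using f by (metis (mono_tags) bij_betw_imp_surj_on mem_Collect_eq subset_imageE)
      then have "card d = k"
        using e f by (metis (mono_tags) bij_betw_def card_image inj_on_subset mem_Collect_eq)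
      with d show "e \<in> (`) f ` {e. e \<subseteq> Q \<and> card e = k}" by blast
    qed
    then have "hypergraph_iso (Hypergraph Q {e. e \<subseteq> Q \<and> card e = k}) (clique k t)"
      unfolding hypergraph_iso_def clique_def using f by (intro exI[of _ f]) simp
    then show "Hypergraph Q {e. e \<subseteq> Q \<and> card e = k} \<in> copies (clique k t) G"
      using \<Q>[OF Q] E[OF Q] by (auto simp: copies_def subhypergraph_def)
  qed
qed (use fin in \<open>rule finite_copies\<close>)

text \<open>Reduces freeness to a statement about links: an isomorphism, read backwards, maps the
  core of the suspension to some \<open>S\<close> and the cycle to four further vertices in cyclic
  order.\<close>

lemma suspension_C4_freeI:
  assumes no: "\<And>S x y z w. finite S \<Longrightarrow> card S = k - 2 \<Longrightarrow> distinct [x, y, z, w] \<Longrightarrow>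
      S \<inter> {x, y, z, w} = {} \<Longrightarrow>
      S \<union> {x, y} \<in> edges G \<Longrightarrow> S \<union> {y, z} \<in> edges G \<Longrightarrow> S \<union> {z, w} \<in> edges G \<Longrightarrow>
      S \<union> {w, x} \<in> edges G \<Longrightarrow> False"
  shows "hypergraph_free (suspension k (cycle_graph 4)) G"
  unfolding hypergraph_free_def
proof safe
  fix G' assume G': "subhypergraph G' G" "hypergraph_iso G' (suspension k (cycle_graph 4))"
  let ?V = "{..<k - 2} <+> {..<4::nat}"
  obtain f where f: "bij_betw f (verts G') ?V"
    "(\<lambda>e. {..<k - 2} <+> e) ` {{i, (i + 1) mod 4} | i. i < (4::nat)} = (`) f ` edges G'"
    using G'(2) by (auto simp: hypergraph_iso_def suspension_def cycle_graph_def)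
  define g where "g = the_inv_into (verts G') f"
  have g: "inj_on g ?V"
    unfolding g_def using f(1) by (metis bij_betw_def inj_on_the_inv_into)
  have gf: "g ` f ` e = e" if "e \<in> edges G'" for e
  proof -
    have "e \<subseteq> verts G'" using G'(1) that by (simp add: subhypergraph_def)
    then show ?thesis
      using f(1) by (force simp: g_def bij_betw_def the_inv_into_f_f image_iff subset_iff)
  qed
  define S where "S = g ` Inl ` {..<k - 2}"
  define x where "x i = g (Inr i)" for i
  have edge: "S \<union> {x i, x j} \<in> edges G" if "i < 4" "j = (i + 1) mod 4" for i j
  proof -
    have "{..<k - 2} <+> {i, j} \<in> (`) f ` edges G'"
      unfolding f(2)[symmetric] using that by blast
    then obtain e where e: "e \<in> edges G'" "{..<k - 2} <+> {i, j} = f ` e" by auto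
    then have "e = g ` ({..<k - 2} <+> {i, j})"
      using gf by simp
    also have "\<dots> = S \<union> {x i, x j}"
      by (auto simp: S_def x_def Plus_def)
    finally show ?thesis
      using e(1) G'(1) by (auto simp: subhypergraph_def)
  qed
  have x: "x i = x j \<longleftrightarrow> i = j" if "i < 4" "j < 4" for i j
    using g that by (simp add: x_def inj_on_eq_iff[of g ?V] InrI)
  have xS: "x i \<notin> S" if "i < 4" for i
  proof
    assume "x i \<in> S"
    then obtain l where "l < k - 2" "g (Inr i) = g (Inl l)"
      by (auto simp: x_def S_def)
    with g that show False
      by (metis Inl_Inr_False InlI InrI inj_on_eq_iff lessThan_iff)
  qed
  have "inj_on g (Inl ` {..<k - 2})"
    using g by (rule inj_on_subset) auto
  then have "card S = k - 2"
    by (simp add: S_def card_image)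
  have e: "S \<union> {x 0, x 1} \<in> edges G" "S \<union> {x 1, x 2} \<in> edges G"
    "S \<union> {x 2, x 3} \<in> edges G" "S \<union> {x 3, x 0} \<in> edges G"
    by (rule edge; simp)+
  show False
    by (rule no[OF _ _ _ _ e]) (use \<open>card S = k - 2\<close> xS x in \<open>auto simp: S_def\<close>)
qed

subsection \<open>The construction\<close>

definition det2 :: "'a::comm_ring \<times> 'a \<Rightarrow> 'a \<times> 'a \<Rightarrow> 'a" where
  "det2 u v = fst u * snd v - snd u * fst v"

definition coord_prod :: "'a::comm_ring \<times> 'a \<Rightarrow> 'a" where
  "coord_prod u = fst u * snd u"

text \<open>This is \<open>det2 (y - x) (z - x)\<close> written cyclically; over a field it vanishes
  exactly when the three points are collinear.\<close>

definition area :: "'a::comm_ring \<times> 'a \<Rightarrow> 'a \<times> 'a \<Rightarrow> 'a \<times> 'a \<Rightarrow> 'a" where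
  "area x y z = det2 x y + det2 y z + det2 z x"

lemma det2_diff_left: "det2 (u - v) w = det2 u w - det2 v w"
  and det2_diff_right: "det2 w (u - v) = det2 w u - det2 w v"
  by (simp_all add: det2_def algebra_simps)

lemma det2_commute: "det2 v u = - det2 u v"
  by (simp add: det2_def algebra_simps)

lemma area_degenerate [simp]: "area x x y = 0" "area x y x = 0" "area x y y = 0"
  by (simp_all add: area_def det2_def algebra_simps)

lemma area_permute:
  "area y z x = area x y z" "area z x y = area x y z"
  "area y x z = - area x y z" "area x z y = - area x y z" "area z y x = - area x y z"
  by (simp_all add: area_def det2_def algebra_simps)

text \<open>Division is avoided: each coordinate of \<open>a\<close> times \<open>det2 b c\<close>
  is 0, and one of the two coordinates is nonzero.\<close>

lemma det2_parallel:
  fixes a b c :: "'a::field \<times> 'a"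
  assumes "a \<noteq> 0" "det2 a b = 0" "det2 a c = 0"
  shows "det2 b c = 0"
proof -
  obtain a1 a2 b1 b2 c1 c2 where [simp]: "a = (a1, a2)" "b = (b1, b2)" "c = (c1, c2)"
    by (metis surj_pair)
  have b: "a1 * b2 = a2 * b1" and c: "a1 * c2 = a2 * c1"
    using assms(2,3) by (simp_all add: det2_def)
  have "a1 * (b1 * c2 - b2 * c1) = b1 * (a1 * c2) - (a1 * b2) * c1"
    by (simp add: algebra_simps)
  also have "\<dots> = 0"
    by (simp add: b c)
  finally have 1: "a1 = 0 \<or> b1 * c2 - b2 * c1 = 0"
    by simp
  have "a2 * (b1 * c2 - b2 * c1) = (a2 * b1) * c2 - b2 * (a2 * c1)"
    by (simp add: algebra_simps)
  also have "\<dots> = 0"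
    by (simp add: b[symmetric] c[symmetric])
  finally have 2: "a2 = 0 \<or> b1 * c2 - b2 * c1 = 0"
    by simp
  from 1 2 \<open>a \<noteq> 0\<close> show ?thesis
    by (auto simp: det2_def zero_prod_def)
qed

text \<open>This excludes 4-cycles. If both differences were nonzero, \<open>z - z'\<close> and
  \<open>z\<close> would be parallel to \<open>u - v\<close>, hence to each other. As
  \<open>u\<close> is also parallel to \<open>z - z'\<close>, it would be parallel to
  \<open>z\<close>, against \<open>c \<noteq> 0\<close>.\<close>

lemma det2_unique_common_solution:
  fixes u v z z' :: "'a::field \<times> 'a"
  assumes "det2 u z = c" "det2 v z = c" "det2 u z' = c" "det2 v z' = c" "c \<noteq> 0"
  shows "u = v \<or> z = z'"
proof (rule ccontr)
  assume "\<not> (u = v \<or> z = z')"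
  then have "u - v \<noteq> 0" "z - z' \<noteq> 0" by simp_all
  have "det2 (u - v) (z - z') = 0" "det2 (u - v) z = 0" "det2 u (z - z') = 0"
    using assms by (simp_all add: det2_diff_left det2_diff_right)
  then have "det2 (z - z') z = 0"
    using det2_parallel \<open>u - v \<noteq> 0\<close> by blast
  moreover have "det2 (z - z') u = 0"
    using \<open>det2 u (z - z') = 0\<close> det2_commute by (metis neg_equal_0_iff_equal)
  ultimately have "det2 u z = 0"
    using det2_parallel \<open>z - z' \<noteq> 0\<close> by blast
  with assms show False by simp
qed

text \<open>The solutions lie on a line through the origin, where the coordinate in which
  \<open>u\<close> is nonzero determines the other one.\<close>

lemma card_det2_eq_0:
  fixes u :: "'a::field \<times> 'a"
  assumes "finite K" "u \<noteq> 0"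
  shows "card {v \<in> K \<times> K. det2 u v = 0} \<le> card K"
proof (cases "fst u = 0")
  case False
  have "inj_on fst {v \<in> K \<times> K. det2 u v = 0}"
    using False by (auto simp: inj_on_def det2_def) (metis mult_left_cancel)
  then show ?thesis
    using assms(1) by (intro card_inj_on_le[of fst]) auto
next
  case True
  then have "snd u \<noteq> 0"
    using assms(2) by (metis prod.collapse zero_prod_def)
  then have "inj_on snd {v \<in> K \<times> K. det2 u v = 0}"
    by (auto simp: inj_on_def det2_def)
  then show ?thesis
    using assms(1) by (intro card_inj_on_le[of snd]) auto
qed

text \<open>The first summand counts the pairs with \<open>u = 0\<close>, the second those with
  \<open>u\<close> nonzero.\<close>

lemma card_det2_eq_0_pairs:
  fixes H :: "('a::field \<times> 'a) set"
  assumes "finite K" "H \<subseteq> K \<times> K"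
  shows "card {(u, v). u \<in> H \<and> v \<in> H \<and> det2 u v = 0} \<le> card H + card H * card K"
proof -
  have fin: "finite H"
    using assms finite_subset by blast
  have "{(u, v). u \<in> H \<and> v \<in> H \<and> det2 u v = 0}
        \<subseteq> {0} \<times> H \<union> (SIGMA u : H - {0}. {v \<in> K \<times> K. det2 u v = 0})"
    using assms(2) by auto
  then have "card {(u, v). u \<in> H \<and> v \<in> H \<and> det2 u v = 0}
        \<le> card ({0} \<times> H \<union> (SIGMA u : H - {0}. {v \<in> K \<times> K. det2 u v = 0}))"
    using fin assms(1) by (intro card_mono finite_UnI finite_SigmaI) auto
  also have "\<dots> \<le> card ({0 :: 'a \<times> 'a} \<times> H) + card (SIGMA u : H - {0}. {v \<in> K \<times> K. det2 u v = 0})"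
    by (rule card_Un_le)
  also have "card ({0 :: 'a \<times> 'a} \<times> H) = card H"
    by (simp add: card_cartesian_product)
  also have "card (SIGMA u : H - {0}. {v \<in> K \<times> K. det2 u v = 0})
      = (\<Sum>u\<in>H - {0}. card {v \<in> K \<times> K. det2 u v = 0})"
    using fin assms(1) by (intro card_SigmaI) auto
  also have "\<dots> \<le> (\<Sum>u\<in>H - {0}. card K)"
    using assms(1) by (intro sum_mono card_det2_eq_0) auto
  also have "\<dots> \<le> card H * card K"
    using fin by (simp add: card_mono)
  finally show ?thesis by simp
qed

section \<open>Arithmetic of a finite plane in characteristic 2\<close>

locale char_2_subplane =
  fixes K :: "'a::field set" and H :: "('a \<times> 'a) set"
  assumes double [simp]: "x + x = (0 :: 'a)"
    and finite_K: "finite K"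
    and K: "0 \<in> K" "x \<in> K \<Longrightarrow> y \<in> K \<Longrightarrow> x + y \<in> K" "x \<in> K \<Longrightarrow> y \<in> K \<Longrightarrow> x * y \<in> K"
    and H_K: "H \<subseteq> K \<times> K"
    and H: "0 \<in> H" "u \<in> H \<Longrightarrow> v \<in> H \<Longrightarrow> u + v \<in> H"
begin

lemma double_left [simp]: "x + (x + y) = (y :: 'a)"
  by (simp flip: add.assoc)

text \<open>As a simp rule this removes all scalar differences, so that identities with signs become
  identities between sums in which equal terms cancel in pairs.\<close>

lemma minus_eq [simp]: "x - y = x + (y :: 'a)"
  using double[of y] by (metis add_diff_cancel_right' double_left add.commute)

text \<open>Every vector is its own negative, so closure under addition makes \<open>H\<close> a
  subgroup.\<close>

lemma uminus_prod_eq [simp]: "- u = (u :: 'a \<times> 'a)"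
  by (rule minus_unique) (simp add: plus_prod_def zero_prod_def)

lemma finite_H: "finite H"
  using H_K finite_K finite_subset by blast

lemma sum_in_H: "f ` A \<subseteq> H \<Longrightarrow> sum f A \<in> H"
  by (induction A rule: infinite_finite_induct) (auto intro: H)

lemma sum_coord_prod_in_K: "f ` A \<subseteq> H \<Longrightarrow> (\<Sum>i\<in>A. coord_prod (f i)) \<in> K"
proof (induction A rule: infinite_finite_induct)
  case (insert i A)
  then have "f i \<in> K \<times> K" using H_K by auto
  then have "coord_prod (f i) \<in> K"
    by (auto simp: coord_prod_def intro: K)
  with insert show ?case by (auto intro: K)
qed (auto intro: K)

text \<open>In the application \<open>x + y + s\<close> is the vertex completing
  \<open>S \<union> {x, y}\<close> to a set with sum 0, where \<open>S\<close> has sum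
  \<open>s\<close>. The first identity expands the quadratic form \<open>coord_prod\<close> at a sum
  of three vectors, its polar form being \<open>det2\<close>. For the second, translation by
  \<open>s\<close> turns the triangle into \<open>u\<close>, \<open>v\<close>,
  \<open>u + v\<close>.\<close>

lemma det2_translate:
  fixes x y s :: "'a \<times> 'a"
  shows "det2 (x + s) (y + s) = coord_prod x + coord_prod y + coord_prod (x + y + s) + coord_prod s"
    and "det2 (x + s) (y + s) = area x y (x + y + s)"
  by (simp_all add: det2_def coord_prod_def area_def distrib_left distrib_right add_ac mult_ac)

section \<open>Admissible sets and the absence of suspended 4-cycles\<close>

definition cliques :: "nat \<Rightarrow> 'a \<Rightarrow> ('a \<times> 'a) set set" where
  "cliques k c = {Q. Q \<subseteq> H \<and> card Q = k + 1 \<and> \<Sum>Q = 0 \<and> sum coord_prod Q = c \<and>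
     (\<forall>x\<in>Q. \<forall>y\<in>Q. \<forall>z\<in>Q. distinct [x, y, z] \<longrightarrow> area x y z \<noteq> 0)}"

definition clique_shadow :: "nat \<Rightarrow> 'a \<Rightarrow> ('a \<times> 'a) hypergraph" where
  "clique_shadow k c = Hypergraph H {e. card e = k \<and> (\<exists>Q\<in>cliques k c. e \<subseteq> Q)}"

text \<open>An admissible set containing the edge has just one more point \<open>w\<close>, and the
  zero sum forces \<open>w = x + y + s\<close>. The prescribed value \<open>c\<close> then fixes the
  determinant, and non-collinearity of \<open>x\<close>, \<open>y\<close>, \<open>w\<close> makes it
  nonzero.\<close>

lemma clique_shadow_edgeD:
  assumes "finite S" "x \<noteq> y" "x \<notin> S" "y \<notin> S" and e: "S \<union> {x, y} \<in> edges (clique_shadow k c)"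
  defines "s \<equiv> \<Sum>S"
  shows "det2 (x + s) (y + s) = c + sum coord_prod S + coord_prod s"
    and "det2 (x + s) (y + s) \<noteq> 0"
proof -
  obtain Q where Q: "Q \<in> cliques k c" "S \<union> {x, y} \<subseteq> Q" and k: "card (S \<union> {x, y}) = k"
    using e by (auto simp: clique_shadow_def)
  have "finite Q"
    using Q(1) finite_H finite_subset by (auto simp: cliques_def)
  have "card (Q - (S \<union> {x, y})) = 1"
    using Q k \<open>finite S\<close> by (subst card_Diff_subset) (auto simp: cliques_def)
  then obtain w where w: "Q - (S \<union> {x, y}) = {w}"
    using card_1_singletonE by blast
  then have Q_eq: "Q = insert w (insert x (insert y S))" and w': "w \<notin> insert x (insert y S)"
    using Q(2) by auto
  have "w + (x + y + s) = 0"
    using Q(1) w' assms(1-4) by (simp add: cliques_def Q_eq s_def add_ac)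
  then have w_eq: "w = x + y + s"
    by (metis minus_unique add.commute uminus_prod_eq)
  have "coord_prod w + (coord_prod x + (coord_prod y + sum coord_prod S)) = c"
    using Q(1) w' assms(1-4) by (simp add: cliques_def Q_eq)
  then show "det2 (x + s) (y + s) = c + sum coord_prod S + coord_prod s"
    unfolding det2_translate(1) w_eq by (auto simp: add_ac)
  have "area x y w \<noteq> 0"
    using Q(1) w' \<open>x \<noteq> y\<close> unfolding cliques_def Q_eq by auto
  then show "det2 (x + s) (y + s) \<noteq> 0"
    unfolding det2_translate(2) w_eq .
qed

lemma hypergraph_free_clique_shadow:
  "hypergraph_free (suspension k (cycle_graph 4)) (clique_shadow k c)"
proof (rule suspension_C4_freeI)
  fix S x y z w
  assume *: "finite S" "distinct [x, y, z, w]" "S \<inter> {x, y, z, w} = {}"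
    and e: "S \<union> {x, y} \<in> edges (clique_shadow k c)" "S \<union> {y, z} \<in> edges (clique_shadow k c)"
      "S \<union> {z, w} \<in> edges (clique_shadow k c)" "S \<union> {w, x} \<in> edges (clique_shadow k c)"
  define s where "s = \<Sum>S"
  \<comment> \<open>The edges are oriented so that the opposite vertices \<open>x\<close> and
    \<open>z\<close> come first; they give two linear equations with \<open>y + s\<close> and
    \<open>w + s\<close> as common solutions.\<close>
  have e': "S \<union> {z, y} \<in> edges (clique_shadow k c)" "S \<union> {x, w} \<in> edges (clique_shadow k c)"
    using e(2,4) by (simp_all add: insert_commute)
  \<comment> \<open>Only \<open>S\<close> and \<open>c\<close> enter, so all four edges yield the
    same value.\<close>
  define d where "d = c + sum coord_prod S + coord_prod s"
  have "det2 (x + s) (y + s) = d" "det2 (z + s) (y + s) = d"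
    "det2 (x + s) (w + s) = d" "det2 (z + s) (w + s) = d"
    unfolding d_def s_def using * by (intro clique_shadow_edgeD(1)[OF _ _ _ _ e(1)]
        clique_shadow_edgeD(1)[OF _ _ _ _ e(3)] clique_shadow_edgeD(1)[OF _ _ _ _ e'(1)]
        clique_shadow_edgeD(1)[OF _ _ _ _ e'(2)]; auto)+
  moreover have "det2 (x + s) (y + s) \<noteq> 0"
    unfolding s_def using * by (intro clique_shadow_edgeD(2)[OF _ _ _ _ e(1)]) auto
  ultimately have "x + s = z + s \<or> y + s = w + s"
    by (intro det2_unique_common_solution) auto
  with * show False by simp
qed

lemma card_cliques_le_ex_copies:
  "card (cliques k c) \<le> ex_copies k (card H) (clique k (k + 1)) (suspension k (cycle_graph 4))"
proof -
  have "card (cliques k c) \<le> card (copies (clique k (k + 1)) (clique_shadow k c))"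
    by (rule card_cliques_le_copies)
      (use finite_H in \<open>auto simp: cliques_def clique_shadow_def\<close>)
  also have "\<dots> \<le> ex_copies k (card H) (clique k (k + 1)) (suspension k (cycle_graph 4))"
    by (rule ex_copies_ge[OF _ _ hypergraph_free_clique_shadow])
      (use finite_H in \<open>auto simp: uniform_hypergraph_def clique_shadow_def cliques_def\<close>)
  finally show ?thesis .
qed

section \<open>Counting tuples with sum zero\<close>

definition zero_sum_tuples :: "nat \<Rightarrow> (nat \<Rightarrow> 'a \<times> 'a) set" where
  "zero_sum_tuples k = {f \<in> {..k} \<rightarrow>\<^sub>E H. sum f {..k} = 0}"

lemma finite_zero_sum_tuples: "finite (zero_sum_tuples k)"
  unfolding zero_sum_tuples_def using finite_H by (simp add: finite_PiE)

text \<open>The first \<open>k\<close> of the \<open>k + 1\<close> entries are free. The last one is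
  their sum, which in characteristic 2 is also the negative of their sum.\<close>

lemma card_zero_sum_tuples_ge: "card H ^ k \<le> card (zero_sum_tuples k)"
proof -
  have "card ({..<k} \<rightarrow>\<^sub>E H) \<le> card (zero_sum_tuples k)"
  proof (rule card_inj_on_le[OF _ _ finite_zero_sum_tuples])
    let ?ext = "\<lambda>f. f(k := sum f {..<k})"
    show "inj_on ?ext ({..<k} \<rightarrow>\<^sub>E H)"
    proof (rule inj_onI)
      fix f g assume fg: "f \<in> {..<k} \<rightarrow>\<^sub>E H" "g \<in> {..<k} \<rightarrow>\<^sub>E H" "?ext f = ?ext g"
      have "f i = g i" if "i \<in> {..<k}" for i
        using that fun_cong[OF fg(3), of i] by simp
      with fg(1,2) show "f = g"
        by (rule PiE_ext)
    qed
    show "?ext ` ({..<k} \<rightarrow>\<^sub>E H) \<subseteq> zero_sum_tuples k"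
    proof (rule image_subsetI)
      fix f assume f: "f \<in> {..<k} \<rightarrow>\<^sub>E H"
      have "sum f {..<k} \<in> H"
        by (intro sum_in_H image_subsetI PiE_mem[OF f])
      then have "?ext f \<in> insert k {..<k} \<rightarrow>\<^sub>E H"
        using f by (rule PiE_fun_upd)
      then have "?ext f \<in> {..k} \<rightarrow>\<^sub>E H"
        by (simp only: lessThan_Suc flip: lessThan_Suc_atMost)
      moreover have "sum (?ext f) {..<k} = sum f {..<k}"
        by (rule sum.cong) simp_all
      then have "sum (?ext f) {..k} = sum f {..<k} + sum f {..<k}"
        by (simp only: lessThan_Suc_atMost[symmetric] sum.lessThan_Suc fun_upd_same)
      then have "sum (?ext f) {..k} = 0"
        by (metis add.left_inverse uminus_prod_eq)
      ultimately show "?ext f \<in> zero_sum_tuples k"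
        by (simp add: zero_sum_tuples_def)
    qed
  qed
  then show ?thesis
    by (simp add: card_PiE)
qed

lemma card_collinear_tuples_le:
  assumes A: "A \<subseteq> {..k}" "card A = 3"
  shows "card {f \<in> zero_sum_tuples k. \<forall>x\<in>f ` A. \<forall>y\<in>f ` A. \<forall>z\<in>f ` A. area x y z = 0}
           \<le> card H ^ (k - 2) * (card H + card H * card K)" (is "card ?B \<le> _")
proof -
  obtain i j l where ijl: "A = {i, j, l}" "i \<noteq> j" "j \<noteq> l" "i \<noteq> l"
    using A(2) by (metis card_3_iff)
  let ?Z = "{(u, v). u \<in> H \<and> v \<in> H \<and> det2 u v = 0}"
  let ?s = "\<lambda>f. sum f ({..k} - A)"
  \<comment> \<open>The shift by the sum of the remaining entries moves the collinearity condition
    to the fixed set \<open>?Z\<close>; it can be undone because the first component determines that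
    sum.\<close>
  define \<phi> where "\<phi> f = (restrict f ({..k} - A), f i + ?s f, f j + ?s f)" for f :: "nat \<Rightarrow> 'a \<times> 'a"
  have last: "f l = f i + f j + ?s f" if "f \<in> zero_sum_tuples k" for f
  proof -
    have "sum f {..k} = ?s f + sum f A"
      using A(1) by (intro sum.subset_diff) auto
    then have "f l + (f i + f j + ?s f) = 0"
      using that ijl by (simp add: zero_sum_tuples_def add_ac)
    then show ?thesis
      by (metis minus_unique add.commute uminus_prod_eq)
  qed
  have fin: "finite (({..k} - A) \<rightarrow>\<^sub>E H)" "finite ?Z"
    using finite_H by (auto intro!: finite_PiE finite_subset[of ?Z "H \<times> H"])
  have "card ?B \<le> card ((({..k} - A) \<rightarrow>\<^sub>E H) \<times> ?Z)"
  proof (rule card_inj_on_le)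
    show "finite ((({..k} - A) \<rightarrow>\<^sub>E H) \<times> ?Z)"
      using fin by (rule finite_cartesian_product)
    show "inj_on \<phi> ?B"
    proof (rule inj_onI)
      fix f g assume fg: "f \<in> ?B" "g \<in> ?B" "\<phi> f = \<phi> g"
      have r: "f a = g a" if "a \<in> {..k} - A" for a
        using fg(3) that unfolding \<phi>_def by (metis prod.inject restrict_apply')
      then have "?s f = ?s g"
        by (rule sum.cong[OF refl])
      with fg(3) have "f i = g i" "f j = g j"
        by (simp_all add: \<phi>_def)
      moreover have "f l = g l"
        using fg(1,2) calculation \<open>?s f = ?s g\<close> by (simp add: last)
      ultimately have "f a = g a" if "a \<in> {..k}" for a
        using r[of a] that ijl(1) by auto
      moreover have "f \<in> {..k} \<rightarrow>\<^sub>E H" "g \<in> {..k} \<rightarrow>\<^sub>E H"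
        using fg by (simp_all add: zero_sum_tuples_def)
      ultimately show "f = g"
        by (metis PiE_ext)
    qed
    show "\<phi> ` ?B \<subseteq> (({..k} - A) \<rightarrow>\<^sub>E H) \<times> ?Z"
    proof (rule image_subsetI)
      fix f assume "f \<in> ?B"
      then have f: "f \<in> zero_sum_tuples k" "\<forall>x\<in>f ` A. \<forall>y\<in>f ` A. \<forall>z\<in>f ` A. area x y z = 0"
        by simp_all
      from f(1) have fH: "f a \<in> H" if "a \<le> k" for a
        using that by (auto simp: zero_sum_tuples_def)
      have "?s f \<in> H"
        by (rule sum_in_H) (use fH in auto)
      moreover have "f i \<in> H" "f j \<in> H"
        using fH A(1) ijl(1) by auto
      moreover have "det2 (f i + ?s f) (f j + ?s f) = area (f i) (f j) (f l)"
        unfolding last[OF f(1)] by (rule det2_translate(2))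
      moreover have "area (f i) (f j) (f l) = 0"
        using f(2) ijl(1) by blast
      ultimately show "\<phi> f \<in> (({..k} - A) \<rightarrow>\<^sub>E H) \<times> ?Z"
        using fH by (auto simp: \<phi>_def intro: H)
    qed
  qed
  also have "\<dots> = card H ^ (k - 2) * card ?Z"
  proof -
    have "card ({..k} - A) = k - 2"
      using A by (subst card_Diff_subset) (auto intro: finite_subset)
    then show ?thesis
      by (simp add: card_cartesian_product card_PiE)
  qed
  also have "\<dots> \<le> card H ^ (k - 2) * (card H + card H * card K)"
    using card_det2_eq_0_pairs[OF finite_K H_K] by (rule mult_le_mono2)
  finally show ?thesis .
qed

text \<open>Such a tuple has distinct entries, so it is one of the \<open>(k + 1)!\<close> orderings
  of an admissible set.\<close>

lemma card_clique_tuples_le: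
  assumes "k \<ge> 2"
  shows "card {f \<in> zero_sum_tuples k. (\<Sum>i\<le>k. coord_prod (f i)) = c \<and>
            (\<forall>i\<le>k. \<forall>j\<le>k. \<forall>l\<le>k. distinct [i, j, l] \<longrightarrow> area (f i) (f j) (f l) \<noteq> 0)}
         \<le> fact (k + 1) * card (cliques k c)" (is "card ?T \<le> _")
proof -
  have fin: "finite (cliques k c)"
    using finite_H by (auto simp: cliques_def intro: finite_subset[of _ "Pow H"])
  have "card ?T \<le> card (\<Union>Q\<in>cliques k c. permutations_of_set Q)"
  proof (rule card_inj_on_le)
    let ?\<phi> = "\<lambda>f. map f [0..<k + 1]"
    show "inj_on ?\<phi> ?T"
    proof (rule inj_onI)
      fix f g assume fg: "f \<in> ?T" "g \<in> ?T" "?\<phi> f = ?\<phi> g"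
      have "f i = g i" if "i \<in> {..k}" for i
        using fg(3) that by (auto simp del: upt_Suc)
      moreover have "f \<in> {..k} \<rightarrow>\<^sub>E H" "g \<in> {..k} \<rightarrow>\<^sub>E H"
        using fg by (simp_all add: zero_sum_tuples_def)
      ultimately show "f = g"
        by (metis PiE_ext)
    qed
    show "?\<phi> ` ?T \<subseteq> (\<Union>Q\<in>cliques k c. permutations_of_set Q)"
    proof (rule image_subsetI)
      fix f assume "f \<in> ?T"
      then have f: "f \<in> zero_sum_tuples k" "(\<Sum>i\<le>k. coord_prod (f i)) = c"
        and noncollinear: "\<forall>i\<le>k. \<forall>j\<le>k. \<forall>l\<le>k. distinct [i, j, l] \<longrightarrow> area (f i) (f j) (f l) \<noteq> 0"
        by simp_all
      have inj: "inj_on f {..k}"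
      proof (rule inj_onI, rule ccontr)
        fix i j assume ij: "i \<in> {..k}" "j \<in> {..k}" "f i = f j" "i \<noteq> j"
        \<comment> \<open>A third index exists because \<open>k \<ge> 2\<close>; with it, two equal
          entries would give a degenerate triangle of area 0.\<close>
        have "card ({..k} - {i, j}) > 0"
          using ij assms by (subst card_Diff_subset) auto
        then obtain l where "l \<in> {..k} - {i, j}"
          by (metis card_gt_0_iff ex_in_conv)
        then have "i \<le> k" "j \<le> k" "l \<le> k" "distinct [i, j, l]"
          using ij by auto
        then show False
          using noncollinear \<open>f i = f j\<close> area_degenerate(1) by metis
      qed
      have "f ` {..k} \<in> cliques k c"
        unfolding cliques_def
      proof (intro CollectI conjI ballI impI)
        show "f ` {..k} \<subseteq> H" "card (f ` {..k}) = k + 1" "\<Sum>(f ` {..k}) = 0"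
          "sum coord_prod (f ` {..k}) = c"
          using f inj by (auto simp: zero_sum_tuples_def card_image sum.reindex)
        fix x y z assume "x \<in> f ` {..k}" "y \<in> f ` {..k}" "z \<in> f ` {..k}" "distinct [x, y, z]"
        then show "area x y z \<noteq> 0"
          using noncollinear by auto
      qed
      moreover have "?\<phi> f \<in> permutations_of_set (f ` {..k})"
        using inj by (intro permutations_of_setI)
          (auto simp: distinct_map atLeast0LessThan lessThan_Suc_atMost simp del: upt_Suc)
      ultimately show "?\<phi> f \<in> (\<Union>Q\<in>cliques k c. permutations_of_set Q)"
        by blast
    qed
    show "finite (\<Union>Q\<in>cliques k c. permutations_of_set Q)"
      using fin by simp
  qed
  also have "\<dots> \<le> (\<Sum>Q\<in>cliques k c. card (permutations_of_set Q))"
    using fin by (rule card_UN_le)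
  also have "\<dots> = (\<Sum>Q\<in>cliques k c. fact (k + 1))"
  proof (rule sum.cong)
    fix Q assume "Q \<in> cliques k c"
    then have "finite Q" "card Q = k + 1"
      using finite_H finite_subset by (auto simp: cliques_def)
    then show "card (permutations_of_set Q) = fact (k + 1)"
      by simp
  qed simp
  finally show ?thesis by (simp add: mult.commute)
qed

text \<open>A tuple without collinear triples falls into one of the \<open>card K\<close> classes
  given by its sum of coordinate products, and every class obeys the same bound. All other tuples
  are covered by a union bound over triples of indices.\<close>

lemma card_power_le_ex_copies:
  assumes "k \<ge> 2"
  shows "card H ^ k \<le>
    card K * (fact (k + 1) * ex_copies k (card H) (clique k (k + 1)) (suspension k (cycle_graph 4))) +
    ((k + 1) choose 3) * (card H ^ (k - 2) * (card H + card H * card K))"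
proof -
  define E where "E = ex_copies k (card H) (clique k (k + 1)) (suspension k (cycle_graph 4))"
  define T where "T c = {f \<in> zero_sum_tuples k. (\<Sum>i\<le>k. coord_prod (f i)) = c \<and>
            (\<forall>i\<le>k. \<forall>j\<le>k. \<forall>l\<le>k. distinct [i, j, l] \<longrightarrow> area (f i) (f j) (f l) \<noteq> 0)}" for c
  define B where "B A = {f \<in> zero_sum_tuples k.
            \<forall>x\<in>f ` A. \<forall>y\<in>f ` A. \<forall>z\<in>f ` A. area x y z = 0}" for A
  define \<A> where "\<A> = {A. A \<subseteq> {..k} \<and> card A = 3}"
  have fin: "finite (T c)" "finite (B A)" for c A
    using finite_zero_sum_tuples[of k] by (simp_all add: T_def B_def)
  have fin\<A>: "finite \<A>"
    unfolding \<A>_def by (rule finite_subset[of _ "Pow {..k}"]) auto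
  have "zero_sum_tuples k \<subseteq> (\<Union>c\<in>K. T c) \<union> (\<Union>A\<in>\<A>. B A)"
  proof
    fix f assume f: "f \<in> zero_sum_tuples k"
    show "f \<in> (\<Union>c\<in>K. T c) \<union> (\<Union>A\<in>\<A>. B A)"
    proof (cases "\<forall>i\<le>k. \<forall>j\<le>k. \<forall>l\<le>k. distinct [i, j, l] \<longrightarrow> area (f i) (f j) (f l) \<noteq> 0")
      case True
      have "(\<Sum>i\<le>k. coord_prod (f i)) \<in> K"
        using f by (intro sum_coord_prod_in_K) (auto simp: zero_sum_tuples_def)
      then show ?thesis
        using f True by (auto simp: T_def)
    next
      case False
      then obtain i j l where ijl: "i \<le> k" "j \<le> k" "l \<le> k" "distinct [i, j, l]"
        "area (f i) (f j) (f l) = 0"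
        by blast
      \<comment> \<open>Reordering the three points changes the area at most by a sign, and repeated
        points have area 0.\<close>
      then have "f \<in> B {i, j, l}"
        using f area_permute[of "f i" "f j" "f l"] by (auto simp: B_def)
      moreover have "{i, j, l} \<in> \<A>"
        using ijl by (auto simp: \<A>_def)
      ultimately show ?thesis by blast
    qed
  qed
  then have "card (zero_sum_tuples k) \<le> card ((\<Union>c\<in>K. T c) \<union> (\<Union>A\<in>\<A>. B A))"
    using fin fin\<A> finite_K by (intro card_mono) auto
  also have "\<dots> \<le> card (\<Union>c\<in>K. T c) + card (\<Union>A\<in>\<A>. B A)"
    by (rule card_Un_le)
  also have "card (\<Union>c\<in>K. T c) \<le> (\<Sum>c\<in>K. card (T c))"
    using finite_K by (rule card_UN_le)
  also have "\<dots> \<le> (\<Sum>c\<in>K. fact (k + 1) * E)"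
  proof (rule sum_mono)
    fix c
    have "card (T c) \<le> fact (k + 1) * card (cliques k c)"
      unfolding T_def using assms by (rule card_clique_tuples_le)
    also have "\<dots> \<le> fact (k + 1) * E"
      unfolding E_def using card_cliques_le_ex_copies by (rule mult_le_mono2)
    finally show "card (T c) \<le> fact (k + 1) * E" .
  qed
  also have "card (\<Union>A\<in>\<A>. B A) \<le> (\<Sum>A\<in>\<A>. card (B A))"
    using fin\<A> by (rule card_UN_le)
  also have "\<dots> \<le> (\<Sum>A\<in>\<A>. card H ^ (k - 2) * (card H + card H * card K))"
    unfolding B_def by (intro sum_mono card_collinear_tuples_le) (auto simp: \<A>_def)
  also have "\<dots> = ((k + 1) choose 3) * (card H ^ (k - 2) * (card H + card H * card K))"
    by (simp add: \<A>_def n_subsets)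
  finally show ?thesis
    using card_zero_sum_tuples_ge[of k] by (simp add: E_def)
qed

end

section \<open>Choice of the field and the final estimate\<close>

lemma two_choose_3_le_fact: "2 * (n choose 3) \<le> fact n"
proof (cases "n \<ge> 3")
  case True
  then have "fact n = 6 * fact (n - 3) * (n choose 3)"
    by (simp add: fact_numeral flip: binomial_fact_lemma)
  moreover have "2 * 1 * (n choose 3) \<le> 6 * fact (n - 3) * (n choose 3)"
    by (intro mult_le_mono) simp_all
  ultimately show ?thesis by simp
qed (simp add: binomial_eq_0)

text \<open>The condition \<open>m \<le> 2 * r\<close> lets a subgroup of order \<open>n\<close> fit
  into a plane of order \<open>q ^ 2\<close>. The collinear tuples cost at most
  \<open>fact (k + 1) * q * n ^ (k - 1)\<close>, which after division becomes the subtracted term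
  \<open>n ^ (k - 1)\<close>.\<close>

lemma power_le_ex_copies:
  fixes k m r :: nat
  assumes "k \<ge> 2" "m \<le> 2 * r" "r \<ge> 1"
  defines "n \<equiv> 2 ^ m" and "q \<equiv> 2 ^ r"
  shows "n ^ k \<le> q * fact (k + 1) *
    (ex_copies k n (clique k (k + 1)) (suspension k (cycle_graph 4)) + n ^ (k - 1))"
proof -
  obtain K :: "bit alg_closure set" where field: "finite K" "card K = q" "0 \<in> K"
    "\<forall>x\<in>K. \<forall>y\<in>K. x + y \<in> K \<and> x * y \<in> K"
    using exists_subfield_of_order_power_of_2[OF \<open>r \<ge> 1\<close>] unfolding q_def by blast
  have "\<exists>H \<subseteq> K \<times> K. card H = 2 ^ m \<and> 0 \<in> H \<and> (\<forall>x\<in>H. \<forall>y\<in>H. x + y \<in> H)"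
  proof (rule exists_subgroup_of_order_power_of_2)
    show "card (K \<times> K) = 2 ^ (2 * r)"
      using field(2) by (simp add: card_cartesian_product q_def power_mult power2_eq_square power_mult_distrib flip: power_add mult_2)
  qed (use assms(2) field in \<open>auto simp: zero_prod_def plus_prod_def double_alg_closure_bit\<close>)
  then obtain H where subgroup: "H \<subseteq> K \<times> K" "card H = n" "0 \<in> H" "\<forall>x\<in>H. \<forall>y\<in>H. x + y \<in> H"
    unfolding n_def by blast
  interpret char_2_subplane K H
    by standard (use field subgroup in \<open>auto simp: double_alg_closure_bit\<close>)
  define E where "E = ex_copies k n (clique k (k + 1)) (suspension k (cycle_graph 4))"
  have "((k + 1) choose 3) * (n ^ (k - 2) * (n + n * q)) = ((k + 1) choose 3) * (1 + q) * n ^ (k - 1)"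
    using \<open>k \<ge> 2\<close> by (simp add: algebra_simps flip: power_Suc power_Suc2 Suc_diff_le)
  \<comment> \<open>Here \<open>1 + q \<le> 2 * q\<close>; the factor 2 is then absorbed by
    \<open>two_choose_3_le_fact\<close>.\<close>
  also have "\<dots> \<le> ((k + 1) choose 3) * (2 * q) * n ^ (k - 1)"
    by (intro mult_le_mono) (simp_all add: q_def)
  also have "\<dots> = (2 * ((k + 1) choose 3)) * (q * n ^ (k - 1))"
    by simp
  also have "\<dots> \<le> fact (k + 1) * (q * n ^ (k - 1))"
    by (intro mult_le_mono1 two_choose_3_le_fact)
  finally have bad: "((k + 1) choose 3) * (n ^ (k - 2) * (n + n * q)) \<le> fact (k + 1) * (q * n ^ (k - 1))" .
  have "n ^ k \<le> q * (fact (k + 1) * E) + ((k + 1) choose 3) * (n ^ (k - 2) * (n + n * q))"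
    using card_power_le_ex_copies[OF \<open>k \<ge> 2\<close>] unfolding subgroup(2) field(2) E_def .
  also have "\<dots> \<le> q * (fact (k + 1) * E) + fact (k + 1) * (q * n ^ (k - 1))"
    using bad by (rule add_left_mono)
  also have "\<dots> = q * fact (k + 1) * (E + n ^ (k - 1))"
    by (simp only: distrib_left ac_simps)
  finally show ?thesis
    unfolding E_def .
qed

theorem theorem1:
  fixes k m n :: nat
  assumes "k \<ge> 2" and "m \<ge> 2" and "n = 2 ^ m"
  shows "(even m \<longrightarrow>
            real (ex_copies k n (clique k (k + 1)) (suspension k (cycle_graph 4)))
              \<ge> real n powr (real k - 1 / 2) / fact (k + 1) - real n ^ (k - 1)) \<and>
         (odd m \<longrightarrow>
            real (ex_copies k n (clique k (k + 1)) (suspension k (cycle_graph 4)))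
              \<ge> real n powr (real k - 1 / 2) / (sqrt 2 * fact (k + 1)) - real n ^ (k - 1))"
proof -
  \<comment> \<open>This is \<open>m / 2\<close> rounded up, the least \<open>r\<close> with
    \<open>m \<le> 2 * r\<close>. The field order \<open>2 ^ r\<close> is \<open>sqrt n\<close> for
    even \<open>m\<close> and \<open>sqrt (2 * n)\<close> for odd \<open>m\<close>, whence the extra
    \<open>sqrt 2\<close>.\<close>
  define r where "r = (m + 1) div 2"
  define E where "E = ex_copies k n (clique k (k + 1)) (suspension k (cycle_graph 4))"
  have "n ^ k \<le> 2 ^ r * fact (k + 1) * (E + n ^ (k - 1))"
    using power_le_ex_copies[of k m r] assms unfolding E_def r_def by simp
  then have "real (n ^ k) \<le> real (2 ^ r * fact (k + 1) * (E + n ^ (k - 1)))"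
    by (rule of_nat_mono)
  then have "real n ^ k \<le> 2 ^ r * fact (k + 1) * (E + real n ^ (k - 1))"
    by (simp del: fact_Suc)
  then have bound: "E \<ge> real n ^ k / (2 ^ r * fact (k + 1)) - real n ^ (k - 1)"
    by (simp add: field_simps del: fact_Suc)
  have powr: "real n powr (real k - 1 / 2) = real n ^ k / sqrt n"
    using assms(3) by (simp add: powr_diff powr_realpow powr_half_sqrt)
  have "2 ^ r = sqrt n" if "even m"
  proof -
    have "(2 ^ r)\<^sup>2 = real n"
      using that by (auto simp: r_def assms(3) elim!: evenE simp flip: power_mult mult.commute)
    then show ?thesis
      by (metis real_sqrt_unique zero_le_numeral zero_le_power)
  qed
  moreover have "2 ^ r = sqrt 2 * sqrt n" if "odd m"
  proof -
    have "(2 ^ r)\<^sup>2 = 2 * real n"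
      using that by (auto simp: r_def assms(3) elim!: oddE simp flip: power_mult)
    then have "2 ^ r = sqrt (2 * real n)"
      by (metis real_sqrt_unique zero_le_numeral zero_le_power)
    then show ?thesis
      by (simp add: real_sqrt_mult)
  qed
  ultimately show ?thesis
    using bound unfolding powr E_def by (cases "even m") (simp_all add: mult_ac del: fact_Suc)
qed

end
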